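(* Let $F$ be a vector lattice, let $\eta_{0}$ be the discrete convergence on $F$ and let $\theta$ be a locally solid additive convergence on $F$. Then: (i) A net $(f_{\alpha})_{\alpha\in A}\subset F_{+}$ is $\eta_{0}\theta$-null iff there is a $\theta$-null net $(g_{\beta})_{\beta\in B}\subset F_{+}$ (equivalently, a decreasing such net) such that for every $\beta$ there is $\alpha_{0}$ such that $f_{\alpha}\le g_{\beta}$ for all $\alpha\ge\alpha_{0}$. (ii) $\eta_{0}\theta$ and $\theta$ have the same decreasing null nets. In fact, $\eta_{0}\theta$ is the strongest locally solid additive convergence on $F$ in which every decreasing $\theta$-null net is null. (iii) If $\theta$ is linear and completely metrizable, then $\eta_{0}\theta=\mathrm{ru}$.
   Context: Nets are indexed by directed sets. A net $(y_\beta)_{\beta\in B}$ is a quasi-subnet of $(x_\alpha)_{\alpha\in A}$ if for every $\alpha_0\in A$ there is $\beta_0\in B$ with $\{y_\beta:\beta\ge\beta_0\}\subset\{x_\alpha:\alpha\ge\alpha_0\}$. A convergence on a set $X$ is a rule specifying which nets in $X$ converge to which points, such that: constant nets converge to their value; a quasi-subnet of a net converging to $x$ converges to $x$; if $(x_\alpha)_{\alpha\in A}$ and $(y_\alpha)_{\alpha\in A}$ converge to $x$ and $z_\alpha\in\{x_\alpha,y_\alpha\}$ for every $\alpha$, then $(z_\alpha)_{\alpha\in A}$ converges to $x$. Let $F$ be a (real) vector lattice with positive cone $F_+$. A net is null (with respect to a convergence) if it converges to $0$. A convergence on $F$ is additive if addition and $f\mapsto -f$ are continuous (preserve convergence of nets),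 and linear if addition and scalar multiplication $\mathbb{R}\times F\to F$ are continuous. An additive convergence is locally solid if $f_\alpha\to 0$ and $|g_\alpha|\le|f_\alpha|$ for all $\alpha$ imply $g_\alpha\to 0$. Such a convergence is determined by its null nets in $F_+$: $f_\alpha\to f$ iff $|f_\alpha-f|\to 0$. $\eta$ is stronger than $\theta$ if $\eta$-convergence implies $\theta$-convergence to the same limit. Composition: for locally solid additive convergences $\eta,\theta$ on $F$, $\eta\theta$ is the locally solid additive convergence such that a net $(f_\alpha)_{\alpha\in A}\subset F_+$ is $\eta\theta$-null iff there is a $\theta$-null net $(g_\beta)_{\beta\in B}\subset F_+$ with $(f_\alpha-g_\beta)^+\xrightarrow[\alpha]{\eta}0$ for every $\beta\in B$; in general $f_\alpha\to f$ iff $|f_\alpha-f|\to 0$. The discrete convergence is the one in which only eventually constant nets converge (to their eventual value). Relative uniform convergence: $f_\alpha\xrightarrow{\mathrm{ru}}f$ if there is $e\in F_+$ such that for every $\varepsilon>0$ there is $\alpha_0$ with $|f_\alpha-f|\le\varepsilon e$ for all $\alpha\ge\alpha_0$. Completely metrizable means that the convergence is the convergence of the topology of a complete metric.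
   Formalization: In (ii), "decreasing null net" is read as a decreasing null net in F₊. This is automatic when θ-limits are unique; without uniqueness the unrestricted claim fails (F = ℝ, every net θ-converges to every point, f_n = −n). *)

theory Defs
  imports "HOL-Analysis.Analysis" "HOL-Library.Lattice_Algebras"
begin

class vector_lattice = ordered_real_vector + lattice_ab_group_add_abs

text \<open>
  A directed set is a directed preorder \<open>r\<close> on the nonempty set \<open>Field r\<close>; \<open>(a, b) \<in> r\<close> means
  \<open>a \<le> b\<close>, so \<open>r `` {a}\<close> is the tail \<open>{b. b \<ge> a}\<close>. A net is such an \<open>r\<close> together with a
  function, whose values outside \<open>Field r\<close> are irrelevant.
\<close>

definition directed :: "'i rel \<Rightarrow> bool" where
  "directed r \<longleftrightarrow> r \<noteq> {} \<and> Preorder r \<and>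
     (\<forall>a\<in>Field r. \<forall>b\<in>Field r. \<exists>c. (a, c) \<in> r \<and> (b, c) \<in> r)"

definition quasi_subnet :: "'j rel \<Rightarrow> ('j \<Rightarrow> 'a) \<Rightarrow> 'i rel \<Rightarrow> ('i \<Rightarrow> 'a) \<Rightarrow> bool" where
  "quasi_subnet s y r x \<longleftrightarrow>
     (\<forall>a\<in>Field r. \<exists>b\<in>Field s. y ` (s `` {b}) \<subseteq> x ` (r `` {a}))"

definition positive_net :: "'i rel \<Rightarrow> ('i \<Rightarrow> 'a::vector_lattice) \<Rightarrow> bool" where
  "positive_net r f \<longleftrightarrow> (\<forall>a\<in>Field r. 0 \<le> f a)"

definition decreasing_net :: "'i rel \<Rightarrow> ('i \<Rightarrow> 'a::order) \<Rightarrow> bool" where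
  "decreasing_net r f \<longleftrightarrow> (\<forall>(a, b)\<in>r. f b \<le> f a)"

definition net_filter :: "'i rel \<Rightarrow> 'i filter" where
  "net_filter r = (INF a\<in>Field r. principal (r `` {a}))"

lemma directed_refl: "directed r \<Longrightarrow> a \<in> Field r \<Longrightarrow> (a, a) \<in> r"
  by (auto simp: directed_def preorder_on_def refl_on_def)

lemma directed_trans: "directed r \<Longrightarrow> (a, b) \<in> r \<Longrightarrow> (b, c) \<in> r \<Longrightarrow> (a, c) \<in> r"
  by (auto simp: directed_def preorder_on_def dest: transD)

lemma directed_upper:
  assumes "directed r" "a \<in> Field r" "b \<in> Field r"
  obtains c where "c \<in> Field r" "(a, c) \<in> r" "(b, c) \<in> r"
  using assms unfolding directed_def by (metis FieldI2)

lemma eventually_net_filter: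
  assumes "directed r"
  shows "eventually P (net_filter r) \<longleftrightarrow> (\<exists>a\<in>Field r. \<forall>b. (a, b) \<in> r \<longrightarrow> P b)"
proof -
  have ne: "Field r \<noteq> {}"
    using assms by (auto simp: directed_def Field_def)
  have "eventually P (net_filter r) \<longleftrightarrow> (\<exists>a\<in>Field r. eventually P (principal (r `` {a})))"
    unfolding net_filter_def
  proof (rule eventually_INF_base[OF ne])
    fix a b assume "a \<in> Field r" "b \<in> Field r"
    then obtain c where "c \<in> Field r" "(a, c) \<in> r" "(b, c) \<in> r"
      using directed_upper[OF assms] by blast
    then show "\<exists>c\<in>Field r. principal (r `` {c}) \<le> inf (principal (r `` {a})) (principal (r `` {b}))"
      using directed_trans[OF assms] by (intro bexI[of _ c]) auto
  qed
  then show ?thesis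
    by (auto simp: eventually_principal)
qed

text \<open>
  HOL cannot quantify over all index sets of all types at once, so a convergence is a relation on
  the nets whose index set lies in a fixed but arbitrary type \<open>'i\<close>. If \<open>'a set \<times> 'a\<close> embeds into
  \<open>'i\<close>, every net in \<open>'a\<close> (over any type) has the same quasi-subnets as some net over \<open>'i\<close> (lemma
  \<open>net_reindex\<close> below), and by the second axiom such nets have the same limits; so nothing is lost.
\<close>

type_synonym ('i, 'a) conv = "'i rel \<Rightarrow> ('i \<Rightarrow> 'a) \<Rightarrow> 'a \<Rightarrow> bool"

definition convergence :: "('i, 'a) conv \<Rightarrow> bool" where
  "convergence \<eta> \<longleftrightarrow>
     (\<forall>r x l. \<eta> r x l \<longrightarrow> directed r) \<and>
     (\<forall>r l. directed r \<longrightarrow> \<eta> r (\<lambda>_. l) l) \<and>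
     (\<forall>r x s y l. \<eta> r x l \<longrightarrow> directed s \<longrightarrow> quasi_subnet s y r x \<longrightarrow> \<eta> s y l) \<and>
     (\<forall>r x y z l. \<eta> r x l \<longrightarrow> \<eta> r y l \<longrightarrow> (\<forall>a\<in>Field r. z a \<in> {x a, y a}) \<longrightarrow> \<eta> r z l)"

definition stronger :: "('i, 'a) conv \<Rightarrow> ('i, 'a) conv \<Rightarrow> bool" where
  "stronger \<eta> \<theta> \<longleftrightarrow> (\<forall>r x l. \<eta> r x l \<longrightarrow> \<theta> r x l)"

definition additive_conv :: "('i, 'a::ab_group_add) conv \<Rightarrow> bool" where
  "additive_conv \<eta> \<longleftrightarrow> convergence \<eta> \<and>
     (\<forall>r x y l m. \<eta> r x l \<longrightarrow> \<eta> r y m \<longrightarrow> \<eta> r (\<lambda>a. x a + y a) (l + m)) \<and>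
     (\<forall>r x l. \<eta> r x l \<longrightarrow> \<eta> r (\<lambda>a. - x a) (- l))"

definition linear_conv :: "('i, 'a::real_vector) conv \<Rightarrow> bool" where
  "linear_conv \<eta> \<longleftrightarrow> convergence \<eta> \<and>
     (\<forall>r x y l m. \<eta> r x l \<longrightarrow> \<eta> r y m \<longrightarrow> \<eta> r (\<lambda>a. x a + y a) (l + m)) \<and>
     (\<forall>r t x c l. (t \<longlongrightarrow> c) (net_filter r) \<longrightarrow> \<eta> r x l \<longrightarrow> \<eta> r (\<lambda>a. t a *\<^sub>R x a) (c *\<^sub>R l))"

definition locally_solid_additive :: "('i, 'a::vector_lattice) conv \<Rightarrow> bool" where
  "locally_solid_additive \<eta> \<longleftrightarrow> additive_conv \<eta> \<and>
     (\<forall>r f g. \<eta> r f 0 \<longrightarrow> (\<forall>a\<in>Field r. \<bar>g a\<bar> \<le> \<bar>f a\<bar>) \<longrightarrow> \<eta> r g 0)"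

text \<open>On the nets in the positive cone, \<open>composition_null\<close> describes the null nets of the composition.\<close>

definition composition_null ::
    "('i, 'a::vector_lattice) conv \<Rightarrow> ('i, 'a) conv \<Rightarrow> 'i rel \<Rightarrow> ('i \<Rightarrow> 'a) \<Rightarrow> bool" where
  "composition_null \<eta> \<theta> r f \<longleftrightarrow> directed r \<and>
     (\<exists>s g. \<theta> s g 0 \<and> positive_net s g \<and> (\<forall>b\<in>Field s. \<eta> r (\<lambda>a. pprt (f a - g b)) 0))"

definition composition ::
    "('i, 'a::vector_lattice) conv \<Rightarrow> ('i, 'a) conv \<Rightarrow> ('i, 'a) conv" where
  "composition \<eta> \<theta> r f l \<longleftrightarrow> composition_null \<eta> \<theta> r (\<lambda>a. \<bar>f a - l\<bar>)"

definition discrete_conv :: "('i, 'a) conv" where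
  "discrete_conv r x l \<longleftrightarrow> directed r \<and> (\<exists>a\<in>Field r. \<forall>b. (a, b) \<in> r \<longrightarrow> x b = l)"

definition ru_conv :: "('i, 'a::vector_lattice) conv" where
  "ru_conv r f l \<longleftrightarrow> directed r \<and>
     (\<exists>e\<ge>0. \<forall>\<epsilon>>0. \<exists>a\<in>Field r. \<forall>b. (a, b) \<in> r \<longrightarrow> \<bar>f b - l\<bar> \<le> \<epsilon> *\<^sub>R e)"

text \<open>The complete metric is not required to be translation invariant.\<close>

definition completely_metrizable_conv :: "('i, 'a) conv \<Rightarrow> bool" where
  "completely_metrizable_conv \<eta> \<longleftrightarrow>
     (\<exists>d. Metric_space UNIV d \<and> Metric_space.mcomplete UNIV d \<and>
       (\<forall>r x l. \<eta> r x l \<longleftrightarrow>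
          directed r \<and> limitin (Metric_space.mtopology UNIV d) x l (net_filter r)))"

lemma net_reindex:
  fixes x :: "'j \<Rightarrow> 'a" and \<iota> :: "'a set \<times> 'a \<Rightarrow> 'i"
  assumes "inj \<iota>" "directed r"
  shows "\<exists>(s :: 'i rel) y. directed s \<and> quasi_subnet s y r x \<and> quasi_subnet r x s y"
proof -
  define T where "T a = x ` (r `` {a})" for a
  define I where "I = {(T a, p) | a p. a \<in> Field r \<and> p \<in> T a}"
  define s where "s = {(\<iota> u, \<iota> v) | u v. u \<in> I \<and> v \<in> I \<and> fst v \<subseteq> fst u}"
  define y where "y = snd \<circ> inv \<iota>"
  have inj: "\<iota> u = \<iota> v \<longleftrightarrow> u = v" for u v
    using assms(1) by (auto dest: injD)
  have y: "y (\<iota> u) = snd u" for u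
    using assms(1) by (simp add: y_def)
  have mem: "(\<iota> u, \<iota> v) \<in> s \<longleftrightarrow> u \<in> I \<and> v \<in> I \<and> fst v \<subseteq> fst u" for u v
    by (cases u, cases v) (auto simp: s_def inj)
  have fld: "Field s = \<iota> ` I"
  proof
    show "Field s \<subseteq> \<iota> ` I" by (auto simp: s_def Field_def)
    have "(\<iota> u, \<iota> u) \<in> s" if "u \<in> I" for u using that mem by blast
    then show "\<iota> ` I \<subseteq> Field s" by (auto intro: FieldI1)
  qed
  have xT: "x a \<in> T a" if "a \<in> Field r" for a
    using directed_refl[OF assms(2) that] by (auto simp: T_def)
  have TT: "T b \<subseteq> T a" if "(a, b) \<in> r" for a b
    using directed_trans[OF assms(2) that] by (auto simp: T_def)
  have T_I: "(T a, x a) \<in> I" if "a \<in> Field r" for a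
    using xT[OF that] that by (auto simp: I_def)
  have img: "y ` (s `` {\<iota> u}) = fst u" if u: "u \<in> I" for u
  proof
    show "y ` (s `` {\<iota> u}) \<subseteq> fst u"
    proof
      fix q assume "q \<in> y ` (s `` {\<iota> u})"
      then obtain v where v: "v \<in> I" "fst v \<subseteq> fst u" "q = y (\<iota> v)"
        by (auto simp: s_def inj)
      then have "snd v \<in> fst v" by (auto simp: I_def)
      then show "q \<in> fst u" using v y by auto
    qed
    obtain a p where ap: "u = (T a, p)" "a \<in> Field r"
      using u by (auto simp: I_def)
    have "q \<in> y ` (s `` {\<iota> u})" if "q \<in> T a" for q
    proof -
      have "(T a, q) \<in> I" using ap that by (auto simp: I_def)
      then have "(\<iota> u, \<iota> (T a, q)) \<in> s" using u ap by (simp add: mem)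
      then show ?thesis 
        by (intro image_eqI[of _ _ "\<iota> (T a, q)"]) (simp_all add: y)
    qed
    then show "fst u \<subseteq> y ` (s `` {\<iota> u})" using ap by auto
  qed
  have "directed s"
    unfolding directed_def
  proof (intro conjI ballI)
    obtain a where "a \<in> Field r"
      using assms(2) by (auto simp: directed_def Field_def)
    then have "(\<iota> (T a, x a), \<iota> (T a, x a)) \<in> s" using T_I by (simp add: mem)
    then show "s \<noteq> {}" by blast
    show "Preorder s"
      unfolding preorder_on_def
    proof (intro conjI)
      show "s \<subseteq> Field s \<times> Field s" by (auto simp: Field_def)
      show "refl_on (Field s) s" unfolding fld by (auto simp: refl_on_def mem)
      show "trans s" 
      proof (rule transI)
        fix i j k assume ij: "(i, j) \<in> s" and jk: "(j, k) \<in> s"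
        obtain u v where uv: "i = \<iota> u" "j = \<iota> v" "u \<in> I" "fst v \<subseteq> fst u"
          using ij unfolding s_def by blast
        obtain w where w: "k = \<iota> w" "w \<in> I" "fst w \<subseteq> fst v"
          using jk mem uv(2) unfolding s_def by (smt (verit) mem_Collect_eq inj prod.inject)
        show "(i, k) \<in> s" using uv w mem by (metis order_trans)
      qed
    qed
    fix i j assume "i \<in> Field s" "j \<in> Field s"
    then obtain u v where uv: "i = \<iota> u" "u \<in> I" "j = \<iota> v" "v \<in> I"
      by (auto simp: fld)
    then obtain a b where ab: "fst u = T a" "a \<in> Field r" "fst v = T b" "b \<in> Field r"
      by (auto simp: I_def)
    then obtain c where c: "c \<in> Field r" "(a, c) \<in> r" "(b, c) \<in> r"
      using directed_upper[OF assms(2)] by blast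
    then have "(i, \<iota> (T c, x c)) \<in> s \<and> (j, \<iota> (T c, x c)) \<in> s"
      using uv ab TT T_I by (auto simp: mem)
    then show "\<exists>k. (i, k) \<in> s \<and> (j, k) \<in> s" by blast
  qed
  moreover have "quasi_subnet s y r x"
    unfolding quasi_subnet_def
  proof
    fix a assume "a \<in> Field r"
    then have "\<iota> (T a, x a) \<in> Field s" "y ` (s `` {\<iota> (T a, x a)}) = T a"
      using T_I img by (auto simp: fld)
    then show "\<exists>b\<in>Field s. y ` (s `` {b}) \<subseteq> x ` (r `` {a})"
      unfolding T_def by blast
  qed
  moreover have "quasi_subnet r x s y"
    unfolding quasi_subnet_def
  proof
    fix i assume "i \<in> Field s"
    then obtain u where u: "i = \<iota> u" "u \<in> I" by (auto simp: fld)
    then obtain a where "a \<in> Field r" "fst u = T a" by (auto simp: I_def)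
    then show "\<exists>b\<in>Field r. x ` (r `` {b}) \<subseteq> y ` (s `` {i})"
      using img[OF u(2)] u(1) by (auto simp: T_def)
  qed
  ultimately show ?thesis by blast
qed

text \<open>
  When limits are unique, decreasing null nets automatically lie in the positive cone. Without
  uniqueness this fails: the convergence in which every net converges to every point is locally
  solid and additive.
\<close>

lemma decreasing_null_positive:
  fixes \<theta> :: "('i, 'a::vector_lattice) conv"
  assumes ls: "locally_solid_additive \<theta>"
    and unique: "\<And>r x l m. \<theta> r x l \<Longrightarrow> \<theta> r x m \<Longrightarrow> l = m"
    and null: "\<theta> r g 0" and decr: "decreasing_net r g"
  shows "positive_net r g"
  unfolding positive_net_def
proof
  fix b assume b: "b \<in> Field r"
  have cv: "convergence \<theta>"
    using ls by (simp add: locally_solid_additive_def additive_conv_def)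
  have dir: "directed r" using cv null unfolding convergence_def by blast
  define n where "n = sup (- g b) 0"
  define h where "h a = (if (b, a) \<in> r then n else 0)" for a
  have "\<bar>h a\<bar> \<le> \<bar>g a\<bar>" for a
  proof (cases "(b, a) \<in> r")
    case True
    then have "g a \<le> g b" using decr by (auto simp: decreasing_net_def)
    then have "- g b \<le> \<bar>g a\<bar>" by (meson abs_ge_minus_self neg_le_iff_le order_trans)
    then have "n \<le> \<bar>g a\<bar>" by (simp add: n_def)
    moreover have "0 \<le> n" by (simp add: n_def)
    ultimately show ?thesis using True by (simp add: h_def)
  qed (simp add: h_def)
  then have h0: "\<theta> r h 0"
    using ls null unfolding locally_solid_additive_def by blast
  have "quasi_subnet r (\<lambda>_. n) r h"
    unfolding quasi_subnet_def
  proof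
    fix a assume a: "a \<in> Field r"
    then obtain c where "c \<in> Field r" "(a, c) \<in> r" "(b, c) \<in> r"
      using directed_upper[OF dir _ b] by blast
    then have "n \<in> h ` (r `` {a})" by (force simp: h_def)
    then show "\<exists>b\<in>Field r. (\<lambda>_. n) ` (r `` {b}) \<subseteq> h ` (r `` {a})"
      using a by auto
  qed
  then have "\<theta> r (\<lambda>_. n) 0" using cv h0 dir unfolding convergence_def by blast
  moreover have "\<theta> r (\<lambda>_. n) n" using cv dir unfolding convergence_def by blast
  ultimately have "n = 0" using unique by blast
  then have "- g b \<le> 0" unfolding n_def by (metis sup_ge1)
  then show "0 \<le> g b" by simp
qed

end

theory Submission
  imports Defs
begin

text \<open>A net of vectors \<open>pprt (\<bar>f a - l\<bar> - g b)\<close> converges to 0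
  discretely exactly when \<open>\<bar>f a - l\<bar> \<le> g b\<close> eventually. So convergence in
  the composition means that every value of some positive \<theta>-null net is an eventual upper
  bound of \<open>\<bar>f a - l\<bar>\<close> (\<open>composition_discrete_iff\<close>). The
  positive eventual upper bounds are closed under \<open>inf\<close>; ordered downwards they form a
  decreasing net, which is \<theta>-null because every \<open>g b\<close> is among them
  (\<open>decreasing_dominating_net\<close>). This gives (i).

  Statement (ii) rests on \<open>null_if_dominated\<close>: in a locally solid additive convergence,
  domination by a null net forces nullity even if the two nets have different index sets. Hence a
  locally solid additive convergence in which the positive decreasing \<theta>-null nets are null
  contains the whole composition (\<open>composition_discrete_stronger\<close>), while a decreasing
  net provides its own eventual upper bounds. Additivity comes from adding two dominating nets;
  since these may be taken decreasing, they can be moved to one index set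
  (\<open>decreasing_nets_common_index\<close>).

  For (iii), a regulator \<open>e\<close> yields the null net of its positive multiples. Conversely,
  completeness lets members of the dominating null net be chosen so that their sum with weights 1,
  2, 3, ... converges to some \<open>e\<close>. Each weighted term lies below \<open>e\<close>, so
  the chosen members lie below \<open>e\<close>, \<open>e\<close>/2, \<open>e\<close>/3, ..., and
  \<open>e\<close> is a regulator.

  The injection \<iota> makes the index type large enough for nets indexed by vectors, or by pairs
  of a set and a vector, to live over it.\<close>

section \<open>Directed sets transported into the index type along an injection\<close>

definition index_order :: "('j \<Rightarrow> 'i) \<Rightarrow> 'j set \<Rightarrow> ('j \<Rightarrow> 'j \<Rightarrow> bool) \<Rightarrow> 'i rel" where
  "index_order \<kappa> A le = {(\<kappa> a, \<kappa> b) | a b. a \<in> A \<and> b \<in> A \<and> le a b}"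

lemma index_order_iff:
  "inj \<kappa> \<Longrightarrow> (\<kappa> a, c) \<in> index_order \<kappa> A le \<longleftrightarrow> a \<in> A \<and> (\<exists>b\<in>A. c = \<kappa> b \<and> le a b)"
  by (auto simp: index_order_def inj_eq)

lemma Field_index_order:
  assumes "\<And>a. a \<in> A \<Longrightarrow> le a a"
  shows "Field (index_order \<kappa> A le) = \<kappa> ` A"
proof
  show "Field (index_order \<kappa> A le) \<subseteq> \<kappa> ` A"
    unfolding index_order_def Field_def by blast
  have "(\<kappa> a, \<kappa> a) \<in> index_order \<kappa> A le" if "a \<in> A" for a
    using that assms unfolding index_order_def by blast
  then show "\<kappa> ` A \<subseteq> Field (index_order \<kappa> A le)"
    by (auto intro: FieldI1)
qed

lemma directed_index_order:
  assumes "inj \<kappa>" "A \<noteq> {}" and refl: "\<And>a. a \<in> A \<Longrightarrow> le a a"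
    and trans: "\<And>a b c. le a b \<Longrightarrow> le b c \<Longrightarrow> le a c"
    and upper: "\<And>a b. a \<in> A \<Longrightarrow> b \<in> A \<Longrightarrow> \<exists>c\<in>A. le a c \<and> le b c"
  shows "directed (index_order \<kappa> A le)"
proof -
  let ?r = "index_order \<kappa> A le"
  have fld: "Field ?r = \<kappa> ` A" by (rule Field_index_order) (rule refl)
  have "?r \<noteq> {}" using assms(2) refl unfolding index_order_def by blast
  moreover have "refl_on (Field ?r) ?r"
    using refl unfolding refl_on_def fld by (auto simp: index_order_def)
  moreover have "trans ?r"
    using trans injD[OF assms(1)] unfolding index_order_def by (intro transI) blast
  moreover have "\<exists>c. (a, c) \<in> ?r \<and> (b, c) \<in> ?r" if "a \<in> Field ?r" "b \<in> Field ?r" for a b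
  proof -
    obtain a' b' where ab: "a = \<kappa> a'" "b = \<kappa> b'" "a' \<in> A" "b' \<in> A"
      using \<open>a \<in> Field ?r\<close> \<open>b \<in> Field ?r\<close> unfolding fld by blast
    then obtain c where "c \<in> A" "le a' c" "le b' c" using upper by blast
    then have "(a, \<kappa> c) \<in> ?r \<and> (b, \<kappa> c) \<in> ?r" using ab unfolding index_order_def by blast
    then show ?thesis by blast
  qed
  ultimately show ?thesis
    by (auto simp: directed_def preorder_on_def Field_def)
qed

lemma directed_Field_nonempty: "directed r \<Longrightarrow> Field r \<noteq> {}"
  by (auto simp: directed_def Field_def)

lemma net_filter_neq_bot: "directed r \<Longrightarrow> net_filter r \<noteq> bot"
  unfolding trivial_limit_def by (auto simp: eventually_net_filter dest: directed_refl)

section \<open>Locally solid convergences and domination across index sets\<close>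

lemma additive_convD:
  assumes "additive_conv \<eta>"
  shows "\<eta> r x l \<Longrightarrow> directed r"
    and "directed r \<Longrightarrow> \<eta> r (\<lambda>_. l) l"
    and "\<eta> r x l \<Longrightarrow> directed s \<Longrightarrow> quasi_subnet s y r x \<Longrightarrow> \<eta> s y l"
    and "\<eta> r x l \<Longrightarrow> \<eta> r y m \<Longrightarrow> \<eta> r (\<lambda>a. x a + y a) (l + m)"
    and "\<eta> r x l \<Longrightarrow> \<eta> r (\<lambda>a. - x a) (- l)"
proof -
  note ac = assms[unfolded additive_conv_def]
  note conv = ac[THEN conjunct1, unfolded convergence_def]
  show "\<eta> r x l \<Longrightarrow> directed r"
    by (erule conv[THEN conjunct1, rule_format])
  show "directed r \<Longrightarrow> \<eta> r (\<lambda>_. l) l"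
    by (erule conv[THEN conjunct2, THEN conjunct1, rule_format])
  show "\<eta> r x l \<Longrightarrow> directed s \<Longrightarrow> quasi_subnet s y r x \<Longrightarrow> \<eta> s y l"
    by (erule (2) conv[THEN conjunct2, THEN conjunct2, THEN conjunct1, rule_format])
  show "\<eta> r x l \<Longrightarrow> \<eta> r y m \<Longrightarrow> \<eta> r (\<lambda>a. x a + y a) (l + m)"
    by (erule (1) ac[THEN conjunct2, THEN conjunct1, rule_format])
  show "\<eta> r x l \<Longrightarrow> \<eta> r (\<lambda>a. - x a) (- l)"
    by (erule ac[THEN conjunct2, THEN conjunct2, rule_format])
qed

lemma locally_solid_additiveD:
  assumes "locally_solid_additive \<eta>"
  shows "additive_conv \<eta>"
    and "\<eta> r f 0 \<Longrightarrow> (\<And>a. a \<in> Field r \<Longrightarrow> \<bar>g a\<bar> \<le> \<bar>f a\<bar>) \<Longrightarrow> \<eta> r g 0"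
  using assms unfolding locally_solid_additive_def by blast+

text \<open>
  The two nets live on different index sets. They are compared through the net of all points of
  the solid hulls of the tails of \<open>g\<close>.
\<close>

lemma null_if_dominated:
  fixes \<theta> :: "('i, 'a::vector_lattice) conv" and \<iota> :: "'a set \<times> 'a \<Rightarrow> 'i"
  assumes \<iota>: "inj \<iota>" and ls: "locally_solid_additive \<theta>"
    and g: "\<theta> s g 0" and r: "directed r"
    and dom: "\<And>b. b \<in> Field s \<Longrightarrow>
      \<exists>a\<in>Field r. \<forall>a'. (a, a') \<in> r \<longrightarrow> (\<exists>b'. (b, b') \<in> s \<and> \<bar>f a'\<bar> \<le> \<bar>g b'\<bar>)"
  shows "\<theta> r f 0"
proof -
  note ac = additive_convD[OF locally_solid_additiveD(1)[OF ls]]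
  have s: "directed s" using ac(1)[OF g] .
  define T where "T b = g ` (s `` {b})" for b
  \<comment> \<open>Each point carries the tail whose solid hull contains it, so that inclusion of
    tails can serve as the order; such pairs are what \<iota> encodes.\<close>
  define J where "J = {(T b, v) | b v. b \<in> Field s \<and> (\<exists>w\<in>T b. \<bar>v\<bar> \<le> \<bar>w\<bar>)}"
  define t where "t = index_order \<iota> J (\<lambda>u v. fst v \<subseteq> fst u)"
  \<comment> \<open>\<open>h\<close> picks a point of the tail that dominates the second component.
    Its values stay in the tails of \<open>g\<close>, so \<open>h\<close> is a quasi-subnet of
    \<open>g\<close>, and solidity passes nullity on to the second components.\<close>
  define h where "h u = (SOME w. w \<in> fst u \<and> \<bar>snd u\<bar> \<le> \<bar>w\<bar>)" for u :: "'a set \<times> 'a"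
  have gT: "g b \<in> T b" if "b \<in> Field s" for b
    using directed_refl[OF s that] by (auto simp: T_def)
  have TJ: "(T b, g b) \<in> J" if "b \<in> Field s" for b
    using gT[OF that] that by (auto simp: J_def)
  have fld: "Field t = \<iota> ` J" unfolding t_def by (rule Field_index_order) simp
  have t: "directed t"
    unfolding t_def
  proof (rule directed_index_order[OF \<iota>])
    show "J \<noteq> {}" using TJ directed_Field_nonempty[OF s] by blast
    fix u v assume "u \<in> J" "v \<in> J"
    then obtain a b where ab: "fst u = T a" "a \<in> Field s" "fst v = T b" "b \<in> Field s"
      by (auto simp: J_def)
    then obtain c where c: "c \<in> Field s" "(a, c) \<in> s" "(b, c) \<in> s"
      using directed_upper[OF s] by blast
    have "T c \<subseteq> T a" "T c \<subseteq> T b"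
      using directed_trans[OF s] c by (auto simp: T_def)
    then show "\<exists>w\<in>J. fst w \<subseteq> fst u \<and> fst w \<subseteq> fst v"
      using ab TJ[OF c(1)] by (intro bexI[of _ "(T c, g c)"]) auto
  qed auto
  have h: "h u \<in> fst u \<and> \<bar>snd u\<bar> \<le> \<bar>h u\<bar>" if "u \<in> J" for u
  proof -
    have "\<exists>w. w \<in> fst u \<and> \<bar>snd u\<bar> \<le> \<bar>w\<bar>" using that by (auto simp: J_def)
    then show ?thesis unfolding h_def by (rule someI_ex)
  qed
  have inv: "inv \<iota> (\<iota> u) = u" for u using \<iota> by simp
  have "quasi_subnet t (h \<circ> inv \<iota>) s g"
    unfolding quasi_subnet_def
  proof
    fix b assume b: "b \<in> Field s"
    have "(h \<circ> inv \<iota>) ` (t `` {\<iota> (T b, g b)}) \<subseteq> T b"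
    proof
      fix w assume "w \<in> (h \<circ> inv \<iota>) ` (t `` {\<iota> (T b, g b)})"
      then obtain u where "u \<in> J" "fst u \<subseteq> T b" "w = h u"
        using inv by (auto simp: t_def index_order_iff[OF \<iota>])
      then show "w \<in> T b" using h by blast
    qed
    then show "\<exists>c\<in>Field t. (h \<circ> inv \<iota>) ` (t `` {c}) \<subseteq> g ` (s `` {b})"
      using TJ[OF b] unfolding T_def fld by blast
  qed
  then have "\<theta> t (h \<circ> inv \<iota>) 0" using ac(3)[OF g t] by blast
  then have null: "\<theta> t (snd \<circ> inv \<iota>) 0"
    by (rule locally_solid_additiveD(2)[OF ls]) (use h inv in \<open>auto simp: fld\<close>)
  \<comment> \<open>For late \<open>a'\<close> the value \<open>f a'\<close> itself belongs to the
    solid hull of \<open>T b\<close>, so it occurs beyond \<open>c\<close> as the second component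
    of \<open>(T b, f a')\<close>.\<close>
  have "quasi_subnet r f t (snd \<circ> inv \<iota>)"
    unfolding quasi_subnet_def
  proof
    fix c assume "c \<in> Field t"
    then obtain b v where bv: "c = \<iota> (T b, v)" "b \<in> Field s" "(T b, v) \<in> J"
      by (auto simp: fld J_def)
    obtain a where a: "a \<in> Field r"
      "\<And>a'. (a, a') \<in> r \<Longrightarrow> \<exists>b'. (b, b') \<in> s \<and> \<bar>f a'\<bar> \<le> \<bar>g b'\<bar>"
      using dom[OF bv(2)] by blast
    have "f a' \<in> (snd \<circ> inv \<iota>) ` (t `` {c})" if "(a, a') \<in> r" for a'
    proof -
      have "(T b, f a') \<in> J" using a(2)[OF that] bv(2) by (auto simp: J_def T_def)
      then have "(c, \<iota> (T b, f a')) \<in> t"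
        using bv by (simp add: t_def index_order_iff[OF \<iota>] inj_eq[OF \<iota>])
      then show ?thesis using inv by (intro image_eqI[of _ _ "\<iota> (T b, f a')"]) auto
    qed
    then show "\<exists>b\<in>Field r. f ` (r `` {b}) \<subseteq> (snd \<circ> inv \<iota>) ` (t `` {c})"
      using a(1) by blast
  qed
  then show ?thesis using ac(3)[OF null r] by blast
qed

section \<open>Eventual upper bounds and the decreasing net they form\<close>

definition eventually_below ::
    "'i rel \<Rightarrow> ('i \<Rightarrow> 'a::order) \<Rightarrow> 'a \<Rightarrow> bool" where
  "eventually_below r f u \<longleftrightarrow> (\<exists>a\<^sub>0\<in>Field r. \<forall>a. (a\<^sub>0, a) \<in> r \<longrightarrow> f a \<le> u)"

lemma eventually_below_mono:
  assumes "eventually_below r f u" "u \<le> v" "\<And>a. a \<in> Field r \<Longrightarrow> g a \<le> f a"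
  shows "eventually_below r g v"
proof -
  obtain a\<^sub>0 where a0: "a\<^sub>0 \<in> Field r" "\<And>a. (a\<^sub>0, a) \<in> r \<Longrightarrow> f a \<le> u"
    using assms(1) unfolding eventually_below_def by blast
  have "g a \<le> v" if "(a\<^sub>0, a) \<in> r" for a
    using assms(3)[OF FieldI2[OF that]] a0(2)[OF that] assms(2) by order
  then show ?thesis using a0(1) unfolding eventually_below_def by blast
qed

lemma eventually_below_combine:
  assumes "directed r" "eventually_below r f u" "eventually_below r g v"
    and "\<And>a. a \<in> Field r \<Longrightarrow> f a \<le> u \<Longrightarrow> g a \<le> v \<Longrightarrow> h a \<le> w"
  shows "eventually_below r h w"
proof -
  obtain a b where ab: "a \<in> Field r" "b \<in> Field r"
    "\<And>c. (a, c) \<in> r \<Longrightarrow> f c \<le> u" "\<And>c. (b, c) \<in> r \<Longrightarrow> g c \<le> v"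
    using assms(2,3) unfolding eventually_below_def by blast
  obtain c where c: "c \<in> Field r" "(a, c) \<in> r" "(b, c) \<in> r"
    using directed_upper[OF assms(1) ab(1,2)] .
  have "h c' \<le> w" if "(c, c') \<in> r" for c'
  proof (rule assms(4))
    show "c' \<in> Field r" using that by (rule FieldI2)
    show "f c' \<le> u" by (rule ab(3)[OF directed_trans[OF assms(1) c(2) that]])
    show "g c' \<le> v" by (rule ab(4)[OF directed_trans[OF assms(1) c(3) that]])
  qed
  then show ?thesis using c(1) unfolding eventually_below_def by blast
qed

text \<open>A positive part vanishes exactly when its argument is at most 0, which turns discrete
  nullity into an eventual inequality. All later arguments use this form of the composition.\<close>

lemma composition_discrete_iff:
  fixes \<theta> :: "('i, 'a::vector_lattice) conv"
  shows "composition discrete_conv \<theta> r f l \<longleftrightarrow> directed r \<and>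
     (\<exists>s g. \<theta> s g 0 \<and> positive_net s g \<and>
       (\<forall>b\<in>Field s. eventually_below r (\<lambda>a. \<bar>f a - l\<bar>) (g b)))"
proof -
  have pprt: "pprt u = 0 \<longleftrightarrow> u \<le> 0" for u :: 'a
    by (simp add: le_zero_iff_zero_pprt)
  have "discrete_conv r (\<lambda>a. pprt (\<bar>f a - l\<bar> - u)) 0 \<longleftrightarrow>
      directed r \<and> eventually_below r (\<lambda>a. \<bar>f a - l\<bar>) u" for u
    by (simp add: discrete_conv_def eventually_below_def pprt)
  then show ?thesis
    unfolding composition_def composition_null_def by (simp cong: conj_cong)
qed

text \<open>
  The decreasing net is the identity on the set of eventual upper bounds of \<open>f\<close>, which is closed
  under infima.
\<close>

lemma decreasing_dominating_net:
  fixes \<theta> :: "('i, 'a::vector_lattice) conv" and \<iota> :: "'a set \<times> 'a \<Rightarrow> 'i"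
  assumes \<iota>: "inj \<iota>" and ls: "locally_solid_additive \<theta>" and r: "directed r"
    and g: "\<theta> s g 0" "positive_net s g" "\<And>b. b \<in> Field s \<Longrightarrow> eventually_below r f (g b)"
  shows "\<exists>t h. \<theta> t h 0 \<and> positive_net t h \<and> decreasing_net t h \<and>
    (\<forall>c\<in>Field t. eventually_below r f (h c))"
proof -
  have s: "directed s" using additive_convD(1)[OF locally_solid_additiveD(1)[OF ls], OF g(1)] .
  define U where "U = {u. 0 \<le> u \<and> eventually_below r f u}"
  \<comment> \<open>Vectors serve as indices here; the empty set merely fills the first slot of
    \<iota>.\<close>
  define \<kappa> where "\<kappa> u = \<iota> ({}, u)" for u
  define t where "t = index_order \<kappa> U (\<lambda>u v. v \<le> u)"
  define h where "h = inv \<kappa>"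
  have \<kappa>: "inj \<kappa>" unfolding \<kappa>_def by (intro injI) (auto dest: injD[OF \<iota>])
  have h: "h (\<kappa> u) = u" for u using \<kappa> by (simp add: h_def)
  have gU: "g b \<in> U" if "b \<in> Field s" for b
    using that g by (simp add: U_def positive_net_def)
  have fld: "Field t = \<kappa> ` U" unfolding t_def by (rule Field_index_order) simp
  have t: "directed t"
    unfolding t_def
  proof (rule directed_index_order[OF \<kappa>])
    show "U \<noteq> {}" using gU directed_Field_nonempty[OF s] by blast
    fix u v assume "u \<in> U" "v \<in> U"
    then have "inf u v \<in> U"
      using eventually_below_combine[OF r, of f u f v f "inf u v"] by (simp add: U_def)
    then show "\<exists>w\<in>U. w \<le> u \<and> w \<le> v" by (meson inf_le1 inf_le2)
  qed auto
  have "\<theta> t h 0"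
  \<comment> \<open>Each \<open>g b\<close> is an index of the new net, and all values beyond it lie
    between 0 and \<open>g b\<close>.\<close>
  proof (rule null_if_dominated[OF \<iota> ls g(1) t])
    fix b assume b: "b \<in> Field s"
    have "\<bar>h c\<bar> \<le> \<bar>g b\<bar>" if "(\<kappa> (g b), c) \<in> t" for c
      using that g(2) b by (auto simp: t_def index_order_iff[OF \<kappa>] h U_def positive_net_def)
    then show "\<exists>a\<in>Field t. \<forall>a'. (a, a') \<in> t \<longrightarrow> (\<exists>b'. (b, b') \<in> s \<and> \<bar>h a'\<bar> \<le> \<bar>g b'\<bar>)"
      using gU[OF b] directed_refl[OF s b] unfolding fld by blast
  qed
  moreover have "positive_net t h" by (auto simp: positive_net_def fld h U_def)
  moreover have "decreasing_net t h" by (auto simp: decreasing_net_def t_def index_order_def h)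
  moreover have "\<forall>c\<in>Field t. eventually_below r f (h c)" by (auto simp: fld h U_def)
  ultimately show ?thesis by (intro exI conjI)
qed

section \<open>The composition is locally solid and additive\<close>

text \<open>Nets can be added only over one index set. Pairs of values, rather than pairs of
  indices, serve as the new indices, since \<iota> encodes vectors. Monotonicity makes both ranges
  directed downwards, so their product with the coordinatewise order is directed. Positivity and the
  bounding property concern single values, and the new nets take only old values.\<close>

lemma decreasing_nets_common_index:
  fixes \<theta> :: "('i, 'a::vector_lattice) conv" and \<iota> :: "'a set \<times> 'a \<Rightarrow> 'i"
  assumes \<iota>: "inj \<iota>" and ls: "locally_solid_additive \<theta>"
    and g: "\<theta> s g 0" "positive_net s g" "decreasing_net s g"
    and g': "\<theta> s' g' 0" "positive_net s' g'" "decreasing_net s' g'"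
  shows "\<exists>t h h'. \<theta> t h 0 \<and> \<theta> t h' 0 \<and> h ` Field t \<subseteq> g ` Field s \<and> h' ` Field t \<subseteq> g' ` Field s'"
proof -
  note dir = additive_convD(1)[OF locally_solid_additiveD(1)[OF ls]]
  have s: "directed s" and s': "directed s'" by (rule dir, fact)+
  define A where "A = g ` Field s \<times> g' ` Field s'"
  \<comment> \<open>A pair of vectors fits under \<iota> once its first entry is turned into a
    singleton.\<close>
  define \<kappa> where "\<kappa> p = \<iota> ({fst p}, snd p)" for p :: "'a \<times> 'a"
  define t where "t = index_order \<kappa> A (\<lambda>p q. fst q \<le> fst p \<and> snd q \<le> snd p)"
  have \<kappa>: "inj \<kappa>" unfolding \<kappa>_def by (intro injI) (auto dest: injD[OF \<iota>] simp: prod_eq_iff)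
  have inv: "inv \<kappa> (\<kappa> p) = p" for p using \<kappa> by simp
  have fld: "Field t = \<kappa> ` A" unfolding t_def by (rule Field_index_order) simp
  have lower: "\<exists>c\<in>Field q. k c \<le> k a \<and> k c \<le> k b"
    if q: "directed q" "decreasing_net q k" "a \<in> Field q" "b \<in> Field q"
    for q :: "'i rel" and k :: "'i \<Rightarrow> 'a" and a b
  proof -
    obtain c where "c \<in> Field q" "(a, c) \<in> q" "(b, c) \<in> q"
      using directed_upper[OF q(1,3,4)] .
    then show ?thesis using q(2) by (auto simp: decreasing_net_def)
  qed
  have t: "directed t"
    unfolding t_def
  proof (rule directed_index_order[OF \<kappa>])
    show "A \<noteq> {}"
      using directed_Field_nonempty[OF s] directed_Field_nonempty[OF s'] by (auto simp: A_def)
    fix p q assume "p \<in> A" "q \<in> A"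
    then obtain a a' b b' where *: "p = (g a, g' a')" "q = (g b, g' b')"
      "a \<in> Field s" "b \<in> Field s" "a' \<in> Field s'" "b' \<in> Field s'" by (auto simp: A_def)
    obtain c c' where "c \<in> Field s" "g c \<le> g a" "g c \<le> g b"
        "c' \<in> Field s'" "g' c' \<le> g' a'" "g' c' \<le> g' b'"
      using lower[OF s g(3) *(3,4)] lower[OF s' g'(3) *(5,6)] by blast
    then show "\<exists>w\<in>A. (fst w \<le> fst p \<and> snd w \<le> snd p) \<and> fst w \<le> fst q \<and> snd w \<le> snd q"
      using * by (intro bexI[of _ "(g c, g' c')"]) (auto simp: A_def)
  qed auto
  have pos: "0 \<le> fst p \<and> 0 \<le> snd p" if "p \<in> A" for p
    using that g(2) g'(2) by (auto simp: A_def positive_net_def)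
  \<comment> \<open>Arbitrary indices, used to complete a value of one net to a pair in
    \<open>A\<close>.\<close>
  obtain b\<^sub>0 b\<^sub>0' where b0: "b\<^sub>0 \<in> Field s" "b\<^sub>0' \<in> Field s'"
    using directed_Field_nonempty[OF s] directed_Field_nonempty[OF s'] by blast
  have "\<theta> t (fst \<circ> inv \<kappa>) 0"
  proof (rule null_if_dominated[OF \<iota> ls g(1) t])
    fix b assume b: "b \<in> Field s"
    have "(g b, g' b\<^sub>0') \<in> A" using b b0 by (simp add: A_def)
    moreover have "\<bar>(fst \<circ> inv \<kappa>) c\<bar> \<le> \<bar>g b\<bar>" if c: "(\<kappa> (g b, g' b\<^sub>0'), c) \<in> t" for c
    proof -
      obtain p where p: "p \<in> A" "c = \<kappa> p" "fst p \<le> g b"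
        using c unfolding t_def index_order_iff[OF \<kappa>] by auto
      have "\<bar>fst p\<bar> \<le> \<bar>g b\<bar>"
        using pos[OF p(1)] order_trans[OF p(3) abs_ge_self] by simp
      then show ?thesis using p(2) inv by simp
    qed
    ultimately show "\<exists>a\<in>Field t. \<forall>a'. (a, a') \<in> t \<longrightarrow> (\<exists>b'. (b, b') \<in> s \<and> \<bar>(fst \<circ> inv \<kappa>) a'\<bar> \<le> \<bar>g b'\<bar>)"
      using directed_refl[OF s b] unfolding fld by blast
  qed
  moreover have "\<theta> t (snd \<circ> inv \<kappa>) 0"
  proof (rule null_if_dominated[OF \<iota> ls g'(1) t])
    fix b assume b: "b \<in> Field s'"
    have "(g b\<^sub>0, g' b) \<in> A" using b b0 by (simp add: A_def)
    moreover have "\<bar>(snd \<circ> inv \<kappa>) c\<bar> \<le> \<bar>g' b\<bar>" if c: "(\<kappa> (g b\<^sub>0, g' b), c) \<in> t" for c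
    proof -
      obtain p where p: "p \<in> A" "c = \<kappa> p" "snd p \<le> g' b"
        using c unfolding t_def index_order_iff[OF \<kappa>] by auto
      have "\<bar>snd p\<bar> \<le> \<bar>g' b\<bar>"
        using pos[OF p(1)] order_trans[OF p(3) abs_ge_self] by simp
      then show ?thesis using p(2) inv by simp
    qed
    ultimately show "\<exists>a\<in>Field t. \<forall>a'. (a, a') \<in> t \<longrightarrow> (\<exists>b'. (b, b') \<in> s' \<and> \<bar>(snd \<circ> inv \<kappa>) a'\<bar> \<le> \<bar>g' b'\<bar>)"
      using directed_refl[OF s' b] unfolding fld by blast
  qed
  moreover have "(fst \<circ> inv \<kappa>) ` Field t \<subseteq> g ` Field s" "(snd \<circ> inv \<kappa>) ` Field t \<subseteq> g' ` Field s'"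
    by (auto simp: fld inv A_def)
  ultimately show ?thesis by (intro exI conjI)
qed

lemma composition_discrete_decreasing:
  fixes \<theta> :: "('i, 'a::vector_lattice) conv" and \<iota> :: "'a set \<times> 'a \<Rightarrow> 'i"
  assumes "inj \<iota>" "locally_solid_additive \<theta>" "composition discrete_conv \<theta> r f l"
  obtains s g where "\<theta> s g 0" "positive_net s g" "decreasing_net s g"
    "\<And>b. b \<in> Field s \<Longrightarrow> eventually_below r (\<lambda>a. \<bar>f a - l\<bar>) (g b)"
proof -
  have "directed r" using assms(3) by (simp add: composition_discrete_iff)
  moreover obtain s g where "\<theta> s g 0" "positive_net s g"
    "\<And>b. b \<in> Field s \<Longrightarrow> eventually_below r (\<lambda>a. \<bar>f a - l\<bar>) (g b)"
    using assms(3) unfolding composition_discrete_iff by blast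
  ultimately show thesis
    using decreasing_dominating_net[OF assms(1,2)] that by blast
qed

lemma composition_discrete_dominated:
  assumes "composition discrete_conv \<theta> r f l" "\<And>a. a \<in> Field r \<Longrightarrow> \<bar>g a - m\<bar> \<le> \<bar>f a - l\<bar>"
  shows "composition discrete_conv \<theta> r g m"
proof -
  have "eventually_below r (\<lambda>a. \<bar>g a - m\<bar>) u" if "eventually_below r (\<lambda>a. \<bar>f a - l\<bar>) u" for u
    by (rule eventually_below_mono[OF that order_refl assms(2)])
  then show ?thesis using assms(1) unfolding composition_discrete_iff by blast
qed

text \<open>One inequality serves two axioms: addition, by the triangle inequality, and mixing,
  where the left side equals one of the two summands on the right. The sum of an eventual bound for
  \<open>x\<close> and one for \<open>y\<close> is an eventual bound for \<open>z\<close>.\<close>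

lemma composition_discrete_combine:
  fixes \<theta> :: "('i, 'a::vector_lattice) conv" and \<iota> :: "'a set \<times> 'a \<Rightarrow> 'i"
  assumes \<iota>: "inj \<iota>" and ls: "locally_solid_additive \<theta>"
    and x: "composition discrete_conv \<theta> r x l" and y: "composition discrete_conv \<theta> r y m"
    and le: "\<And>a. a \<in> Field r \<Longrightarrow> \<bar>z a - n\<bar> \<le> \<bar>x a - l\<bar> + \<bar>y a - m\<bar>"
  shows "composition discrete_conv \<theta> r z n"
proof -
  have r: "directed r" using x by (simp add: composition_discrete_iff)
  obtain s g where g: "\<theta> s g 0" "positive_net s g" "decreasing_net s g"
    "\<And>b. b \<in> Field s \<Longrightarrow> eventually_below r (\<lambda>a. \<bar>x a - l\<bar>) (g b)"
    using composition_discrete_decreasing[OF \<iota> ls x] by blast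
  obtain s' g' where g': "\<theta> s' g' 0" "positive_net s' g'" "decreasing_net s' g'"
    "\<And>b. b \<in> Field s' \<Longrightarrow> eventually_below r (\<lambda>a. \<bar>y a - m\<bar>) (g' b)"
    using composition_discrete_decreasing[OF \<iota> ls y] by blast
  obtain t h h' where h: "\<theta> t h 0" "\<theta> t h' 0" "h ` Field t \<subseteq> g ` Field s"
      "h' ` Field t \<subseteq> g' ` Field s'"
    using decreasing_nets_common_index[OF \<iota> ls g(1-3) g'(1-3)] by blast
  have "\<theta> t (\<lambda>c. h c + h' c) 0"
    using additive_convD(4)[OF locally_solid_additiveD(1)[OF ls], OF h(1,2)] by simp
  moreover have "0 \<le> h c + h' c \<and> eventually_below r (\<lambda>a. \<bar>z a - n\<bar>) (h c + h' c)"
    if c: "c \<in> Field t" for c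
  proof -
    obtain b b' where b: "b \<in> Field s" "h c = g b" "b' \<in> Field s'" "h' c = g' b'"
      using c h(3,4) by blast
    have "eventually_below r (\<lambda>a. \<bar>z a - n\<bar>) (g b + g' b')"
      by (rule eventually_below_combine[OF r g(4)[OF b(1)] g'(4)[OF b(3)]])
         (rule order_trans[OF le add_mono])
    then show ?thesis using b g(2) g'(2) by (simp add: positive_net_def)
  qed
  ultimately show ?thesis
    using r unfolding composition_discrete_iff positive_net_def by blast
qed

lemma composition_discrete_locally_solid_additive:
  fixes \<theta> :: "('i, 'a::vector_lattice) conv" and \<iota> :: "'a set \<times> 'a \<Rightarrow> 'i"
  assumes \<iota>: "inj \<iota>" and ls: "locally_solid_additive \<theta>"
  shows "locally_solid_additive (composition discrete_conv \<theta>)"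
proof -
  let ?c = "composition discrete_conv \<theta>"
  note ac = additive_convD[OF locally_solid_additiveD(1)[OF ls]]
  have const: "?c r (\<lambda>_. l) l" if "directed r" for r l
  proof -
    have "eventually_below r (\<lambda>a. \<bar>l - l\<bar>) 0"
      using directed_Field_nonempty[OF that] by (auto simp: eventually_below_def)
    then show ?thesis
      using ac(2)[OF that, of 0] that
      unfolding composition_discrete_iff positive_net_def by auto
  qed
  have sub: "?c s y l" if x: "?c r x l" and "directed s" and q: "quasi_subnet s y r x" for r x s y l
  proof -
    \<comment> \<open>An eventual bound restricts only the set of values on some tail, so a
      quasi-subnet inherits it with the same \<open>u\<close>.\<close>
    have "eventually_below s (\<lambda>a. \<bar>y a - l\<bar>) u" if u: "eventually_below r (\<lambda>a. \<bar>x a - l\<bar>) u" for u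
    proof -
      obtain a where a: "a \<in> Field r" "\<And>a'. (a, a') \<in> r \<Longrightarrow> \<bar>x a' - l\<bar> \<le> u"
        using u unfolding eventually_below_def by blast
      obtain b where "b \<in> Field s" "y ` (s `` {b}) \<subseteq> x ` (r `` {a})"
        using q a(1) unfolding quasi_subnet_def by blast
      moreover from this have "\<bar>y b' - l\<bar> \<le> u" if "(b, b') \<in> s" for b'
      proof -
        have "y b' \<in> x ` (r `` {a})" using calculation(2) that by blast
        then show ?thesis using a(2) by auto
      qed
      ultimately show ?thesis unfolding eventually_below_def by blast
    qed
    then show ?thesis using x \<open>directed s\<close> unfolding composition_discrete_iff by blast
  qed
  have mix: "?c r z l" if "?c r x l" "?c r y l" "\<forall>a\<in>Field r. z a \<in> {x a, y a}" for r x y z l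
  proof (rule composition_discrete_combine[OF \<iota> ls that(1,2)])
    fix a assume "a \<in> Field r"
    then show "\<bar>z a - l\<bar> \<le> \<bar>x a - l\<bar> + \<bar>y a - l\<bar>"
      using that(3) by (auto simp: le_add_same_cancel1 le_add_same_cancel2)
  qed
  have add: "?c r (\<lambda>a. x a + y a) (l + m)" if "?c r x l" "?c r y m" for r x y l m
  proof (rule composition_discrete_combine[OF \<iota> ls that])
    fix a
    have "x a + y a - (l + m) = (x a - l) + (y a - m)" by simp
    then show "\<bar>x a + y a - (l + m)\<bar> \<le> \<bar>x a - l\<bar> + \<bar>y a - m\<bar>"
      by (metis abs_triangle_ineq)
  qed
  have neg: "?c r (\<lambda>a. - x a) (- l)" if "?c r x l" for r x l
    by (rule composition_discrete_dominated[OF that]) (simp add: abs_minus_commute)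
  have solid: "?c r g 0" if "?c r f 0" "\<forall>a\<in>Field r. \<bar>g a\<bar> \<le> \<bar>f a\<bar>" for r f g
    by (rule composition_discrete_dominated[OF that(1)]) (use that(2) in simp)
  have dir: "directed r" if "?c r x l" for r x l
    using that by (simp add: composition_discrete_iff)
  show ?thesis
    unfolding locally_solid_additive_def additive_conv_def convergence_def
    by (intro conjI allI impI, erule dir, erule const, erule (2) sub, erule (2) mix,
        erule (1) add, erule neg, erule (1) solid)
qed

section \<open>Maximality of the composition\<close>

text \<open>The dominating \<theta>-null net can be taken decreasing, so it is also \<zeta>-null,
  and domination then works inside \<zeta>. The case \<zeta> = \<theta> shows that the composition
  is stronger than \<theta>.\<close>

lemma composition_discrete_stronger:
  fixes \<theta> \<zeta> :: "('i, 'a::vector_lattice) conv" and \<iota> :: "'a set \<times> 'a \<Rightarrow> 'i"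
  assumes \<iota>: "inj \<iota>" and ls: "locally_solid_additive \<theta>" and \<zeta>: "locally_solid_additive \<zeta>"
    and decr: "\<And>r f. positive_net r f \<Longrightarrow> decreasing_net r f \<Longrightarrow> \<theta> r f 0 \<Longrightarrow> \<zeta> r f 0"
  shows "stronger (composition discrete_conv \<theta>) \<zeta>"
  unfolding stronger_def
proof (intro allI impI)
  fix r x l assume c: "composition discrete_conv \<theta> r x l"
  then have r: "directed r" by (simp add: composition_discrete_iff)
  obtain s g where g: "\<theta> s g 0" "positive_net s g" "decreasing_net s g"
    "\<And>b. b \<in> Field s \<Longrightarrow> eventually_below r (\<lambda>a. \<bar>x a - l\<bar>) (g b)"
    using composition_discrete_decreasing[OF \<iota> ls c] by blast
  have \<zeta>g: "\<zeta> s g 0" using decr g by blast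
  note ac = additive_convD[OF locally_solid_additiveD(1)[OF \<zeta>]]
  have s: "directed s" using ac(1)[OF \<zeta>g] .
  have "\<zeta> r (\<lambda>a. x a - l) 0"
  proof (rule null_if_dominated[OF \<iota> \<zeta> \<zeta>g r])
    fix b assume b: "b \<in> Field s"
    then have "\<bar>g b\<bar> = g b" using g(2) by (simp add: positive_net_def)
    then show "\<exists>a\<in>Field r. \<forall>a'. (a, a') \<in> r \<longrightarrow> (\<exists>b'. (b, b') \<in> s \<and> \<bar>x a' - l\<bar> \<le> \<bar>g b'\<bar>)"
      using g(4)[OF b] directed_refl[OF s b] unfolding eventually_below_def by metis
  qed
  from ac(4)[OF this ac(2)[OF r, of l]]
  show "\<zeta> r x l" by simp
qed

section \<open>Relative uniform convergence\<close>

text \<open>Continuity of scalar multiplication makes the multiples of the regulator, with positive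
  factors tending to 0, a \<theta>-null net of eventual bounds.\<close>

lemma ru_imp_composition_discrete:
  fixes \<theta> :: "('i, 'a::vector_lattice) conv" and \<iota> :: "'a set \<times> 'a \<Rightarrow> 'i"
  assumes \<iota>: "inj \<iota>" and lin: "linear_conv \<theta>" and ru: "ru_conv r f l"
  shows "composition discrete_conv \<theta> r f l"
proof -
  have const: "\<theta> s (\<lambda>_. v) v" if "directed s" for s v
    using lin that by (simp add: linear_conv_def convergence_def)
  have scale: "\<theta> s (\<lambda>a. t a *\<^sub>R x a) (c *\<^sub>R v)" if "(t \<longlongrightarrow> c) (net_filter s)" "\<theta> s x v" for s t x c v
    by (rule lin[unfolded linear_conv_def, THEN conjunct2, THEN conjunct2, rule_format, OF that])
  have r: "directed r" using ru by (simp add: ru_conv_def)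
  obtain e where e: "0 \<le> e" "\<And>\<epsilon>. 0 < \<epsilon> \<Longrightarrow> eventually_below r (\<lambda>a. \<bar>f a - l\<bar>) (\<epsilon> *\<^sub>R e)"
    using ru unfolding ru_conv_def eventually_below_def by blast
  show ?thesis
  proof (cases "e = 0")
    case True
    then have "eventually_below r (\<lambda>a. \<bar>f a - l\<bar>) 0" using e(2)[of 1] by simp
    then show ?thesis
      using const[OF r, of 0] r unfolding composition_discrete_iff positive_net_def by auto
  next
    case False
    \<comment> \<open>A scalar is encoded by the corresponding multiple of \<open>e\<close>. This is
      injective only for nonzero \<open>e\<close>, hence the case split.\<close>
    define \<kappa> where "\<kappa> \<epsilon> = \<iota> ({}, \<epsilon> *\<^sub>R e)" for \<epsilon> :: real
    define s where "s = index_order \<kappa> {0<..} (\<lambda>\<delta> \<epsilon>. \<epsilon> \<le> \<delta>)"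
    have \<kappa>: "inj \<kappa>"
      using False unfolding \<kappa>_def by (intro injI) (auto dest: injD[OF \<iota>])
    have inv: "inv \<kappa> (\<kappa> \<epsilon>) = \<epsilon>" for \<epsilon> using \<kappa> by simp
    have fld: "Field s = \<kappa> ` {0<..}" unfolding s_def by (rule Field_index_order) simp
    have s: "directed s"
      unfolding s_def
    proof (rule directed_index_order[OF \<kappa>])
      fix a b :: real assume "a \<in> {0<..}" "b \<in> {0<..}"
      then show "\<exists>c\<in>{0<..}. c \<le> a \<and> c \<le> b" by (intro bexI[of _ "min a b"]) auto
    qed auto
    have "(inv \<kappa> \<longlongrightarrow> 0) (net_filter s)"
    proof (rule tendstoI)
      fix \<epsilon> :: real assume \<epsilon>: "0 < \<epsilon>"
      have "dist (inv \<kappa> b) 0 < \<epsilon>" if "(\<kappa> (\<epsilon> / 2), b) \<in> s" for b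
        using that \<epsilon> by (auto simp: s_def index_order_iff[OF \<kappa>] inv)
      then show "\<forall>\<^sub>F b in net_filter s. dist (inv \<kappa> b) 0 < \<epsilon>"
        unfolding eventually_net_filter[OF s] fld using \<epsilon> by (intro bexI[of _ "\<kappa> (\<epsilon> / 2)"]) auto
    qed
    from scale[OF this const[OF s, of e]] have "\<theta> s (\<lambda>b. inv \<kappa> b *\<^sub>R e) 0" by simp
    moreover have "0 \<le> inv \<kappa> b *\<^sub>R e \<and> eventually_below r (\<lambda>a. \<bar>f a - l\<bar>) (inv \<kappa> b *\<^sub>R e)"
      if "b \<in> Field s" for b
      using that e by (auto simp: fld inv intro!: scaleR_nonneg_nonneg)
    ultimately show ?thesis
      using r unfolding composition_discrete_iff positive_net_def by blast
  qed
qed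

text \<open>For \<open>k \<ge> n\<close> the positive part of \<open>\<sigma> n - e\<close> is at
  most \<open>\<bar>\<sigma> k - e\<bar>\<close>, which tends to 0. So this constant is null, and
  uniqueness of metric limits makes it 0.\<close>

lemma sequence_limit_upper_bound:
  fixes \<theta> :: "('i, 'a::vector_lattice) conv" and \<iota> :: "'a set \<times> 'a \<Rightarrow> 'i"
  assumes \<iota>: "inj \<iota>" and ls: "locally_solid_additive \<theta>" and d: "Metric_space UNIV d"
    and \<theta>: "\<And>r x l. \<theta> r x l \<longleftrightarrow> directed r \<and> limitin (Metric_space.mtopology UNIV d) x l (net_filter r)"
    and lim: "limitin (Metric_space.mtopology UNIV d) \<sigma> e sequentially" and inc: "incseq \<sigma>"
  shows "\<sigma> n \<le> e"
proof -
  interpret Metric_space UNIV d by (rule d)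
  note ac = additive_convD[OF locally_solid_additiveD(1)[OF ls]]
  define N where "N = {(m, n). m \<le> (n::nat)}"
  have N: "directed N"
  proof -
    have "\<exists>k. m \<le> k \<and> n \<le> k" for m n :: nat by (rule exI[of _ "max m n"]) simp
    then show ?thesis
      unfolding directed_def N_def preorder_on_def
      by (auto simp: refl_on_def trans_def Field_def)
  qed
  have FN: "Field N = UNIV" by (auto simp: N_def Field_def)
  \<comment> \<open>\<theta> knows only nets over \<open>'i\<close>, so the sequence is replaced by
    such a net with the same quasi-subnets.\<close>
  obtain s :: "'i rel" and y where y: "directed s" "quasi_subnet s y N \<sigma>"
    using net_reindex[OF \<iota> N] by blast
  have ytail: "\<exists>b\<in>Field s. \<forall>b'. (b, b') \<in> s \<longrightarrow> (\<exists>k\<ge>m. y b' = \<sigma> k)" for m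
    using y(2) unfolding quasi_subnet_def FN by (fastforce simp: N_def)
  have "limitin mtopology y e (net_filter s)"
    unfolding limitin_metric eventually_net_filter[OF y(1)]
  proof (intro conjI allI impI)
    fix \<epsilon> :: real assume "0 < \<epsilon>"
    then obtain m where m: "\<And>k. k \<ge> m \<Longrightarrow> d (\<sigma> k) e < \<epsilon>"
      using lim unfolding limitin_metric eventually_sequentially by blast
    show "\<exists>a\<in>Field s. \<forall>b. (a, b) \<in> s \<longrightarrow> y b \<in> UNIV \<and> d (y b) e < \<epsilon>"
      using ytail[of m] m by (metis UNIV_I)
  qed simp
  then have "\<theta> s y e" using \<theta> y(1) by blast
  from ac(4)[OF this ac(2)[OF y(1), of "- e"]]
  have y0: "\<theta> s (\<lambda>b. y b - e) 0" by simp
  define p where "p = sup (\<sigma> n - e) 0"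
  have p0: "0 \<le> p" by (simp add: p_def)
  have "\<theta> s (\<lambda>_. p) 0"
  proof (rule null_if_dominated[OF \<iota> ls y0 y(1)])
    fix b assume b: "b \<in> Field s"
    obtain c where c: "c \<in> Field s" "\<And>c'. (c, c') \<in> s \<Longrightarrow> \<exists>k\<ge>n. y c' = \<sigma> k"
      using ytail by blast
    obtain a where a: "a \<in> Field s" "(b, a) \<in> s" "(c, a) \<in> s"
      using directed_upper[OF y(1) b c(1)] by blast
    have "\<sigma> n \<le> y a" using c(2)[OF a(3)] incseqD[OF inc] by auto
    then have "\<sigma> n - e \<le> \<bar>y a - e\<bar>" by (meson abs_ge_self diff_right_mono order_trans)
    then have "\<bar>p\<bar> \<le> \<bar>y a - e\<bar>" using p0 by (simp add: p_def)
    then show "\<exists>a\<in>Field s. \<forall>a'. (a, a') \<in> s \<longrightarrow> (\<exists>b'. (b, b') \<in> s \<and> \<bar>p\<bar> \<le> \<bar>y b' - e\<bar>)"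
      using a by blast
  qed
  moreover have "\<theta> s (\<lambda>_. p) p" using ac(2)[OF y(1)] .
  ultimately have "p = 0"
    using \<theta> limitin_metric_unique net_filter_neq_bot[OF y(1)] by blast
  then have "\<sigma> n - e \<le> 0" unfolding p_def by (metis sup_ge1)
  then show ?thesis by simp
qed

lemma (in Metric_space) MCauchy_geometric:
  assumes "range \<sigma> \<subseteq> M" and step: "\<And>n. d (\<sigma> n) (\<sigma> (Suc n)) < (1/2) ^ n"
  shows "MCauchy \<sigma>"
proof -
  have M: "\<sigma> n \<in> M" for n using assms(1) by blast
  \<comment> \<open>The bound is the exact geometric sum from \<open>m\<close> to
    \<open>n - 1\<close>, which lets the induction close.\<close>
  have le: "d (\<sigma> m) (\<sigma> n) \<le> 2 * (1/2) ^ m - 2 * (1/2) ^ n" if "m \<le> n" for m n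
    using that
  proof (induction n rule: dec_induct)
    case (step n)
    have "d (\<sigma> m) (\<sigma> (Suc n)) \<le> d (\<sigma> m) (\<sigma> n) + d (\<sigma> n) (\<sigma> (Suc n))"
      using M triangle by blast
    then show ?case using step assms(2)[of n] by simp
  qed (simp add: M)
  have bound: "d (\<sigma> m) (\<sigma> n) < 2 * (1/2) ^ N" if "N \<le> m" "m \<le> n" for m n N
  proof -
    have "(1/2 :: real) ^ m \<le> (1/2) ^ N" using that by (intro power_decreasing) auto
    moreover have "(0::real) < (1/2) ^ n" by simp
    ultimately show ?thesis using le[OF that(2)] by linarith
  qed
  show ?thesis
    unfolding MCauchy_def
  proof (intro conjI allI impI assms(1))
    fix \<epsilon> :: real assume "0 < \<epsilon>"
    then obtain N where N: "(1/2 :: real) ^ N < \<epsilon> / 2"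
      using real_arch_pow_inv[of "\<epsilon> / 2" "1/2"] by auto
    have "d (\<sigma> m) (\<sigma> n) < \<epsilon>" if "N \<le> m" "N \<le> n" for m n
    proof (cases "m \<le> n")
      case True
      then show ?thesis using bound[OF that(1) True] N by linarith
    next
      case False
      then show ?thesis using bound[OF that(2), of m] N by (simp add: commute)
    qed
    then show "\<exists>N. \<forall>n n'. N \<le> n \<longrightarrow> N \<le> n' \<longrightarrow> d (\<sigma> n) (\<sigma> n') < \<epsilon>" by blast
  qed
qed

text \<open>
  Since the metric need not be translation invariant, smallness of the terms would not make the
  partial sums Cauchy. Each term is therefore chosen small relative to the partial sum it is
  added to, so that the partial sums move by less than \<open>(1/2) ^ n\<close>.
\<close>

lemma composition_discrete_imp_ru:
  fixes \<theta> :: "('i, 'a::vector_lattice) conv" and \<iota> :: "'a set \<times> 'a \<Rightarrow> 'i"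
  assumes \<iota>: "inj \<iota>" and ls: "locally_solid_additive \<theta>" and lin: "linear_conv \<theta>"
    and cm: "completely_metrizable_conv \<theta>" and c: "composition discrete_conv \<theta> r f l"
  shows "ru_conv r f l"
proof -
  obtain d where d: "Metric_space UNIV d" "Metric_space.mcomplete UNIV d"
    and \<theta>: "\<And>r x l. \<theta> r x l \<longleftrightarrow> directed r \<and> limitin (Metric_space.mtopology UNIV d) x l (net_filter r)"
    using cm unfolding completely_metrizable_conv_def by blast
  interpret Metric_space UNIV d by (rule d)
  have r: "directed r" using c by (simp add: composition_discrete_iff)
  obtain s g where g: "\<theta> s g 0" "positive_net s g"
    "\<And>b. b \<in> Field s \<Longrightarrow> eventually_below r (\<lambda>a. \<bar>f a - l\<bar>) (g b)"
    using c unfolding composition_discrete_iff by blast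
  note ac = additive_convD[OF locally_solid_additiveD(1)[OF ls]]
  have s: "directed s" using ac(1)[OF g(1)] .
  \<comment> \<open>For fixed \<open>x\<close> and \<open>n\<close>, linearity makes
    \<open>x + real (Suc n) *\<^sub>R g b\<close> converge to \<open>x\<close>. The weight
    \<open>Suc n\<close> later becomes the divisor of \<open>e\<close>.\<close>
  have "\<exists>b\<in>Field s. d x (x + real (Suc n) *\<^sub>R g b) < (1/2) ^ n" for x n
  proof -
    have "\<theta> s (\<lambda>b. real (Suc n) *\<^sub>R g b) (real (Suc n) *\<^sub>R 0)"
      using lin g(1) tendsto_const unfolding linear_conv_def by blast
    from ac(4)[OF ac(2)[OF s, of x] this]
    have "limitin mtopology (\<lambda>b. x + real (Suc n) *\<^sub>R g b) x (net_filter s)"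
      by (simp add: \<theta>)
    then have "\<forall>\<^sub>F b in net_filter s. d (x + real (Suc n) *\<^sub>R g b) x < (1/2) ^ n"
      unfolding limitin_metric by simp
    then show ?thesis
      unfolding eventually_net_filter[OF s] using directed_refl[OF s] commute by metis
  qed
  then obtain B where B: "B x n \<in> Field s" "d x (x + real (Suc n) *\<^sub>R g (B x n)) < (1/2) ^ n" for x n
    by metis
  define \<sigma> where "\<sigma> = rec_nat 0 (\<lambda>n x. x + real (Suc n) *\<^sub>R g (B x n))"
  have \<sigma>: "\<sigma> 0 = 0" "\<sigma> (Suc n) = \<sigma> n + real (Suc n) *\<^sub>R g (B (\<sigma> n) n)" for n
    by (simp_all add: \<sigma>_def)
  have gpos: "0 \<le> real (Suc n) *\<^sub>R g (B x n)" for x n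
    using g(2) B(1) by (intro scaleR_nonneg_nonneg) (auto simp: positive_net_def)
  have inc: "incseq \<sigma>"
    by (intro incseq_SucI) (simp only: \<sigma> le_add_same_cancel1 gpos)
  have "MCauchy \<sigma>" by (rule MCauchy_geometric) (simp_all only: \<sigma> B subset_UNIV)
  then obtain e where "limitin mtopology \<sigma> e sequentially"
    using d(2) unfolding mcomplete_def by blast
  then have \<sigma>_le: "\<sigma> n \<le> e" for n
    using sequence_limit_upper_bound[OF \<iota> ls d(1) \<theta> _ inc] by blast
  have e0: "0 \<le> e" using \<sigma>_le[of 0] by (simp add: \<sigma>)
  have "eventually_below r (\<lambda>a. \<bar>f a - l\<bar>) (\<epsilon> *\<^sub>R e)" if \<epsilon>: "0 < \<epsilon>" for \<epsilon>
  proof -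
    obtain n where n: "inverse (real (Suc n)) < \<epsilon>" using reals_Archimedean[OF \<epsilon>] by blast
    let ?g = "g (B (\<sigma> n) n)"
    have "0 \<le> \<sigma> n" using incseqD[OF inc, of 0 n] by (simp add: \<sigma>)
    \<comment> \<open>All terms are positive, so a single one lies below the partial sum that ends
      with it, and thus below \<open>e\<close>.\<close>
    then have "real (Suc n) *\<^sub>R ?g \<le> \<sigma> (Suc n)" unfolding \<sigma>(2) by (simp only: le_add_same_cancel2)
    then have "real (Suc n) *\<^sub>R ?g \<le> e" using \<sigma>_le order_trans by blast
    then have "inverse (real (Suc n)) *\<^sub>R (real (Suc n) *\<^sub>R ?g) \<le> inverse (real (Suc n)) *\<^sub>R e"
      by (rule scaleR_left_mono) simp
    also have "\<dots> \<le> \<epsilon> *\<^sub>R e" using n e0 by (intro scaleR_right_mono) auto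
    finally have "?g \<le> \<epsilon> *\<^sub>R e" by simp
    then show ?thesis by (rule eventually_below_mono[OF g(3)[OF B(1)]]) simp
  qed
  then show ?thesis using r e0 unfolding ru_conv_def eventually_below_def by blast
qed

section \<open>The three statements together\<close>

theorem theorem2p7:
  fixes \<theta> :: "('i, 'f::vector_lattice) conv"
    and \<iota> :: "'f set \<times> 'f \<Rightarrow> 'i"
  assumes "inj \<iota>"
    and "locally_solid_additive \<theta>"
  shows
    "(\<forall>r f. directed r \<longrightarrow> positive_net r f \<longrightarrow>
        (composition discrete_conv \<theta> r f 0 \<longleftrightarrow>
          (\<exists>s g. \<theta> s g 0 \<and> positive_net s g \<and>
            (\<forall>b\<in>Field s. \<exists>a\<^sub>0\<in>Field r. \<forall>a. (a\<^sub>0, a) \<in> r \<longrightarrow> f a \<le> g b))) \<and>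
        (composition discrete_conv \<theta> r f 0 \<longleftrightarrow>
          (\<exists>s g. \<theta> s g 0 \<and> positive_net s g \<and> decreasing_net s g \<and>
            (\<forall>b\<in>Field s. \<exists>a\<^sub>0\<in>Field r. \<forall>a. (a\<^sub>0, a) \<in> r \<longrightarrow> f a \<le> g b)))) \<and>
     (\<forall>r f. directed r \<longrightarrow> positive_net r f \<longrightarrow> decreasing_net r f \<longrightarrow>
        (composition discrete_conv \<theta> r f 0 \<longleftrightarrow> \<theta> r f 0)) \<and>
     (locally_solid_additive (composition discrete_conv \<theta>) \<and>
      (\<forall>r f. positive_net r f \<longrightarrow> decreasing_net r f \<longrightarrow> \<theta> r f 0 \<longrightarrow>
        composition discrete_conv \<theta> r f 0) \<and>
      (\<forall>\<zeta> :: ('i, 'f) conv. locally_solid_additive \<zeta> \<longrightarrow>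
        (\<forall>r f. positive_net r f \<longrightarrow> decreasing_net r f \<longrightarrow> \<theta> r f 0 \<longrightarrow> \<zeta> r f 0) \<longrightarrow>
        stronger (composition discrete_conv \<theta>) \<zeta>)) \<and>
     (linear_conv \<theta> \<longrightarrow> completely_metrizable_conv \<theta> \<longrightarrow>
        composition discrete_conv \<theta> = ru_conv)"
proof -
  note \<iota> = assms(1) and ls = assms(2)
  let ?c = "composition discrete_conv \<theta>"
  have pos: "eventually_below r (\<lambda>a. \<bar>f a - 0\<bar>) u \<longleftrightarrow> eventually_below r f u"
    if "positive_net r f" for r :: "'i rel" and f :: "'i \<Rightarrow> 'f" and u
    using that unfolding eventually_below_def positive_net_def
    by (metis FieldI2 abs_of_nonneg diff_zero)
  have char: "?c r f 0 \<longleftrightarrow> (\<exists>s g. \<theta> s g 0 \<and> positive_net s g \<and> (\<forall>b\<in>Field s. eventually_below r f (g b)))"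
    if "directed r" "positive_net r f" for r f
    unfolding composition_discrete_iff pos[OF that(2)] using that(1) by blast
  have char': "?c r f 0 \<longleftrightarrow> (\<exists>s g. \<theta> s g 0 \<and> positive_net s g \<and> decreasing_net s g \<and>
      (\<forall>b\<in>Field s. eventually_below r f (g b)))" if "directed r" "positive_net r f" for r f
    using decreasing_dominating_net[OF \<iota> ls that(1), of _ _ f] unfolding char[OF that] by blast
  have dir: "directed r" if "\<theta> r f l" for r f l
    using additive_convD(1)[OF locally_solid_additiveD(1)[OF ls], OF that] .
  have decr: "?c r f 0" if "positive_net r f" "decreasing_net r f" "\<theta> r f 0" for r f
  proof -
    \<comment> \<open>A decreasing net is bounded by \<open>f b\<close> from the index
      \<open>b\<close> on, so it can be its own dominating net.\<close>
    have "\<forall>b\<in>Field r. eventually_below r f (f b)"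
      using that(2) unfolding eventually_below_def decreasing_net_def by blast
    then show ?thesis using char[OF dir[OF that(3)] that(1)] that by blast
  qed
  have strong: "stronger ?c \<zeta>"
    if "locally_solid_additive \<zeta>"
      "\<forall>r f. positive_net r f \<longrightarrow> decreasing_net r f \<longrightarrow> \<theta> r f 0 \<longrightarrow> \<zeta> r f 0" for \<zeta>
    using composition_discrete_stronger[OF \<iota> ls that(1)] that(2) by blast
  have "\<theta> r f 0" if "?c r f 0" for r f
    using strong[OF ls] that unfolding stronger_def by blast
  then have same: "?c r f 0 \<longleftrightarrow> \<theta> r f 0" if "positive_net r f" "decreasing_net r f" for r f
    using decr that by blast
  have ru: "?c = ru_conv" if "linear_conv \<theta>" "completely_metrizable_conv \<theta>"
    using composition_discrete_imp_ru[OF \<iota> ls that] ru_imp_composition_discrete[OF \<iota> that(1)]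
    by (intro ext iffI)
  show ?thesis
    by (intro conjI allI impI, erule (1) char[unfolded eventually_below_def],
        erule (1) char'[unfolded eventually_below_def], erule (1) same,
        rule composition_discrete_locally_solid_additive[OF \<iota> ls], erule (2) decr,
        erule (1) strong, erule (1) ru)
qed

end
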